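(* Let $m\ge 1$, $I=\{1,\dots,m\}$, let $\{U_i\}_{i\in I}$ be a family of linear subspaces of $\mathbb{R}^n$, and let $S=\bigcap_{i\in I}U_i$. For any $s\in S$ and any $x\in\mathbb{R}^n$, it holds that $C(x)=P_{W_x}(s)$; that is, the orthogonal projection of $s$ onto $W_x$ is the unique point $C(x)$ of $W_x$ that is equidistant to $x,x^{(1)},\dots,x^{(m)}$. (Here $x^{(i)}$, $W_x$ and $C(x)$ are as defined in the context.)
   Context: $\mathbb{R}^n$ carries the standard scalar product and Euclidean norm $\|\cdot\|$. For a linear or affine subspace $V$, $P_V$ denotes the orthogonal projection onto $V$; for a linear subspace $V$, $R_V=2P_V-\mathrm{Id}$ is the reflection onto $V$. No relation between $m$ and $n$ is required. For $x\in\mathbb{R}^n$ and $i\in I$ put $x^{(i)}=R_{U_i}\cdots R_{U_2}R_{U_1}(x)$, and let $W_x=\operatorname{aff}\{x,x^{(1)},\dots,x^{(m)}\}$ (affine hull). Circumcenter: $C(x)$ denotes the point such that (a) $C(x)\in W_x$ and (b) $\|C(x)-x\|=\|C(x)-x^{(i)}\|$ for all $i\in I$. *)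

theory Defs
  imports "HOL-Analysis.Analysis"
begin

(* Meaningful for nonempty affine V, where existence and uniqueness are given by orth_proj_ex1;
   for a linear subspace V the condition says that x - p is orthogonal to V (orth_proj_subspace). *)
definition orth_proj :: "(real^'n) set \<Rightarrow> real^'n \<Rightarrow> real^'n" where
  "orth_proj V x = (THE p. p \<in> V \<and> (\<forall>v\<in>V. orthogonal (x - p) (v - p)))"

definition reflection :: "(real^'n) set \<Rightarrow> real^'n \<Rightarrow> real^'n" where
  "reflection V x = 2 *\<^sub>R orth_proj V x - x"

(* iter_refl U i x is x^(i) = R_{U_i} ... R_{U_2} R_{U_1} x; the index 0 stands for x itself. *)
primrec iter_refl :: "(nat \<Rightarrow> (real^'n) set) \<Rightarrow> nat \<Rightarrow> real^'n \<Rightarrow> real^'n" where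
  "iter_refl U 0 x = x"
| "iter_refl U (Suc i) x = reflection (U (Suc i)) (iter_refl U i x)"

definition refl_hull :: "(nat \<Rightarrow> (real^'n) set) \<Rightarrow> nat \<Rightarrow> real^'n \<Rightarrow> (real^'n) set" where
  "refl_hull U m x = affine hull (insert x ((\<lambda>i. iter_refl U i x) ` {1..m}))"

definition is_circumcenter :: "(nat \<Rightarrow> (real^'n) set) \<Rightarrow> nat \<Rightarrow> real^'n \<Rightarrow> real^'n \<Rightarrow> bool" where
  "is_circumcenter U m x c \<longleftrightarrow>
     c \<in> refl_hull U m x \<and> (\<forall>i\<in>{1..m}. norm (c - x) = norm (c - iter_refl U i x))"

(* A definite description: nothing here asserts that such a point exists or is unique. *)
definition circumcenter :: "(nat \<Rightarrow> (real^'n) set) \<Rightarrow> nat \<Rightarrow> real^'n \<Rightarrow> real^'n" where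
  "circumcenter U m x = (THE c. is_circumcenter U m x c)"

lemma orth_proj_ex1:
  fixes V :: "(real^'n) set"
  assumes "affine V" "V \<noteq> {}"
  shows "\<exists>!p. p \<in> V \<and> (\<forall>v\<in>V. orthogonal (x - p) (v - p))"
proof -
  have "affine hull V = V"
    using assms(1) by (simp only: affine_hull_eq)
  with closed_affine_hull[of V] have cl: "closed V" "convex V"
    using affine_imp_convex[OF assms(1)] by simp_all
  define p where "p = closest_point V x"
  have p: "p \<in> V"
    using cl assms by (simp add: p_def closest_point_in_set)
  have le: "(x - p) \<bullet> (v - p) \<le> 0" if "v \<in> V" for v
    using closest_point_dot[OF cl(2,1) that] by (simp add: p_def)
  have orth: "orthogonal (x - p) (v - p)" if "v \<in> V" for v
  proof -
    have "2 *\<^sub>R p + (-1) *\<^sub>R v \<in> V"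
      using mem_affine[OF assms(1) p that, of 2 "-1"] by simp
    from le[OF this] have "(x - p) \<bullet> (p - v) \<le> 0"
      by (simp add: scaleR_2)
    with le[OF that] show ?thesis
      by (simp add: orthogonal_def inner_diff_right)
  qed
  have "q = p" if q: "q \<in> V" "\<forall>v\<in>V. orthogonal (x - q) (v - q)" for q
  proof -
    have "(x - q) \<bullet> (p - q) = 0" "(x - p) \<bullet> (q - p) = 0"
      using q(2) p orth[OF q(1)] by (simp_all add: orthogonal_def)
    hence "(p - q) \<bullet> (p - q) = 0"
      by (simp add: inner_diff_left inner_diff_right inner_commute)
    thus ?thesis by simp
  qed
  with p orth show ?thesis by blast
qed

lemma orth_proj_subspace:
  fixes V :: "(real^'n) set"
  assumes "subspace V"
  shows "orth_proj V x = p \<longleftrightarrow> p \<in> V \<and> (\<forall>v\<in>V. orthogonal (x - p) v)"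
proof -
  have V: "affine V" "V \<noteq> {}"
    using assms subspace_imp_affine subspace_0 by blast+
  have eq: "(\<forall>v\<in>V. orthogonal (x - p) (v - p)) \<longleftrightarrow> (\<forall>v\<in>V. orthogonal (x - p) v)"
    if "p \<in> V"
  proof
    assume L: "\<forall>v\<in>V. orthogonal (x - p) (v - p)"
    show "\<forall>v\<in>V. orthogonal (x - p) v"
    proof
      fix v assume "v \<in> V"
      hence "v + p \<in> V" using that assms by (simp add: subspace_add)
      from L[rule_format, OF this] show "orthogonal (x - p) v" by simp
    qed
  next
    assume "\<forall>v\<in>V. orthogonal (x - p) v"
    thus "\<forall>v\<in>V. orthogonal (x - p) (v - p)"
      using that assms by (simp add: subspace_diff)
  qed
  have "orth_proj V x = p \<longleftrightarrow> p \<in> V \<and> (\<forall>v\<in>V. orthogonal (x - p) (v - p))"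
  proof
    assume "orth_proj V x = p"
    thus "p \<in> V \<and> (\<forall>v\<in>V. orthogonal (x - p) (v - p))"
      using theI'[OF orth_proj_ex1[OF V, of x]] by (simp add: orth_proj_def)
  next
    assume "p \<in> V \<and> (\<forall>v\<in>V. orthogonal (x - p) (v - p))"
    thus "orth_proj V x = p"
      unfolding orth_proj_def by (rule the1_equality[OF orth_proj_ex1[OF V]])
  qed
  with eq show ?thesis by blast
qed

end

theory Submission
  imports Defs
begin

text \<open>
  A point \<open>s\<close> common to all the subspaces is fixed by every reflection, and reflections are
  isometries, so \<open>s\<close> is equidistant from \<open>x\<close> and all its iterated reflections
  (\<open>norm_diff_iter_refl\<close>). It need not lie in their affine hull, but projecting it there keeps the
  equidistance: by Pythagoras, passing from \<open>s\<close> to its projection lowers the squared distance to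
  every point of the hull by the same amount, the squared distance from \<open>s\<close> to the hull.
  The projection is therefore a circumcenter. There is no other one, because the difference of two
  points equidistant from a set is orthogonal to the directions of its affine hull, whereas the
  difference of two points of the hull is such a direction (\<open>equidistant_in_affine_hull_unique\<close>).
\<close>

lemma orth_proj_affine:
  fixes V :: "(real^'n) set"
  assumes "affine V" "V \<noteq> {}"
  shows orth_proj_in: "orth_proj V x \<in> V"
    and orth_proj_orthogonal: "v \<in> V \<Longrightarrow> orthogonal (x - orth_proj V x) (v - orth_proj V x)"
  using theI'[OF orth_proj_ex1[OF assms, of x]] by (simp_all add: orth_proj_def)

text \<open>
  With \<open>p\<close> the projection of \<open>x\<close>, the vectors \<open>s - x\<close> and \<open>s - reflection V x\<close> are the
  difference and the sum of the orthogonal vectors \<open>s - p\<close> and \<open>x - p\<close>.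
\<close>
lemma norm_diff_reflection:
  fixes V :: "(real^'n) set"
  assumes "subspace V" "s \<in> V"
  shows "norm (s - reflection V x) = norm (s - x)"
proof -
  define p where "p = orth_proj V x"
  have "affine V" "V \<noteq> {}"
    using assms subspace_imp_affine by blast+
  then have "(x - p) \<bullet> (s - p) = 0"
    using orth_proj_orthogonal[of V s x] assms(2) by (simp add: p_def orthogonal_def)
  then have "norm ((s - p) + (x - p)) = norm ((s - p) - (x - p))"
    unfolding norm_eq inner_add_left inner_add_right[of _ "s - p" "x - p"]
      inner_diff_left[of "s - p" "x - p"] inner_diff_right[of _ "s - p" "x - p"]
    by (simp only: inner_commute[of "s - p" "x - p"])
  moreover have "s - reflection V x = (s - p) + (x - p)" "s - x = (s - p) - (x - p)"
    by (simp_all add: reflection_def p_def scaleR_2)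
  ultimately show ?thesis
    by (simp only:)
qed

lemma norm_diff_iter_refl:
  fixes U :: "nat \<Rightarrow> (real^'n) set"
  assumes "\<And>j. j \<in> {1..i} \<Longrightarrow> subspace (U j)" "\<And>j. j \<in> {1..i} \<Longrightarrow> s \<in> U j"
  shows "norm (s - iter_refl U i x) = norm (s - x)"
  using assms
proof (induction i)
  case (Suc i)
  then show ?case
    using norm_diff_reflection[of "U (Suc i)" s "iter_refl U i x"] by simp
qed simp

lemma norm_diff_orth_proj_eq:
  fixes V :: "(real^'n) set"
  assumes "affine V" "x \<in> V" "y \<in> V" "norm (s - y) = norm (s - x)"
  shows "norm (orth_proj V s - y) = norm (orth_proj V s - x)"
proof -
  define p where "p = orth_proj V s"
  have pythagoras: "(norm (s - v))\<^sup>2 = (norm (s - p))\<^sup>2 + (norm (p - v))\<^sup>2" if "v \<in> V" for v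
  proof -
    have "orthogonal (s - p) (v - p)"
      using orth_proj_orthogonal[OF assms(1) _ that, of s] that by (auto simp: p_def)
    then have "orthogonal (s - p) (p - v)"
      by (simp add: orthogonal_def inner_diff_right)
    then show ?thesis
      using norm_add_Pythagorean[of "s - p" "p - v"] by simp
  qed
  have "(norm (p - y))\<^sup>2 = (norm (p - x))\<^sup>2"
    using pythagoras[OF assms(2)] pythagoras[OF assms(3)] assms(4) by simp
  then show ?thesis
    by (simp add: p_def)
qed

text \<open>
  Equidistance of \<open>c\<close> from \<open>x\<close> and \<open>y\<close> is a linear equation in \<open>c\<close> with normal vector \<open>y - x\<close>, so
  \<open>c - d\<close> solves the homogeneous one. The hyperplane through \<open>x\<close> with normal \<open>c - d\<close> thus
  contains the whole affine hull, in particular \<open>c\<close> and \<open>d\<close>.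
\<close>
lemma equidistant_in_affine_hull_unique:
  fixes A :: "'a::real_inner set"
  assumes hull: "c \<in> affine hull A" "d \<in> affine hull A"
    and c: "\<And>y. y \<in> A \<Longrightarrow> norm (c - y) = norm (c - x)"
    and d: "\<And>y. y \<in> A \<Longrightarrow> norm (d - y) = norm (d - x)"
  shows "c = d"
proof -
  let ?H = "{y. (c - d) \<bullet> y = (c - d) \<bullet> x}"
  have "A \<subseteq> ?H"
  proof
    fix y assume "y \<in> A"
    then have "(c - y) \<bullet> (c - y) = (c - x) \<bullet> (c - x)" "(d - y) \<bullet> (d - y) = (d - x) \<bullet> (d - x)"
      using c d by (simp_all add: norm_eq)
    then show "y \<in> ?H"
      by (simp add: inner_diff_left inner_diff_right inner_commute)
  qed
  then have "affine hull A \<subseteq> ?H"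
    by (intro hull_minimal affine_hyperplane)
  then have "c \<in> ?H" "d \<in> ?H"
    using hull by blast+
  then have "(c - d) \<bullet> c = (c - d) \<bullet> d"
    by simp
  then have "(c - d) \<bullet> (c - d) = 0"
    by (simp add: inner_diff_right)
  then show ?thesis
    by simp
qed

theorem lemma3p1:
  fixes U :: "nat \<Rightarrow> (real^'n) set" and m :: nat and s x :: "real^'n"
  assumes "m \<ge> 1"
    and "\<And>i. i \<in> {1..m} \<Longrightarrow> subspace (U i)"
    and "s \<in> (\<Inter>i\<in>{1..m}. U i)"
  shows "(\<exists>!c. is_circumcenter U m x c) \<and>
         is_circumcenter U m x (orth_proj (refl_hull U m x) s) \<and>
         circumcenter U m x = orth_proj (refl_hull U m x) s"
proof -
  define A where "A = insert x ((\<lambda>i. iter_refl U i x) ` {1..m})"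
  define W where "W = refl_hull U m x"
  have W: "W = affine hull A"
    by (simp add: W_def A_def refl_hull_def)
  have circumcenter_iff:
    "is_circumcenter U m x c \<longleftrightarrow> c \<in> W \<and> (\<forall>y\<in>A. norm (c - y) = norm (c - x))" for c
    by (auto simp: is_circumcenter_def W_def A_def)
  have "affine W" "A \<subseteq> W" "x \<in> A"
    by (auto simp: W A_def hull_subset)
  have equidistant: "norm (s - y) = norm (s - x)" if "y \<in> A" for y
    using that assms(2,3) by (auto simp: A_def intro!: norm_diff_iter_refl)
  have "norm (orth_proj W s - y) = norm (orth_proj W s - x)" if "y \<in> A" for y
    using norm_diff_orth_proj_eq[OF \<open>affine W\<close> _ _ equidistant[OF that]]
      that \<open>A \<subseteq> W\<close> \<open>x \<in> A\<close> by blast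
  moreover have "orth_proj W s \<in> W"
    using orth_proj_in \<open>affine W\<close> \<open>A \<subseteq> W\<close> \<open>x \<in> A\<close> by blast
  ultimately have proj: "is_circumcenter U m x (orth_proj W s)"
    by (simp add: circumcenter_iff)
  have unique: "c = orth_proj W s" if "is_circumcenter U m x c" for c
    using that proj equidistant_in_affine_hull_unique[of c A "orth_proj W s" x]
    by (simp add: circumcenter_iff W)
  have "circumcenter U m x = orth_proj W s"
    unfolding circumcenter_def using proj unique by (rule the_equality)
  with proj unique show ?thesis
    unfolding W_def by blast
qed

end
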